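(* For every integer $n \geq 0$, let $$I_n(q,t) := \sum_{T\in \mathrm{Tree}(n+1)} q^{\mathrm{inv}(T)}\, t^{\mathrm{lev}(T)-1}, \qquad \widetilde{I}_n(q,t) := \sum_{\pi\in \mathrm{PF}(n)} q^{\mathrm{cosum}(\pi)}\, t^{\mathrm{exced}(\pi)},$$ regarded as polynomials in $q$ and $t$. Then $$I_n(q,0)=\widetilde{I}_n(q,0)= [n]_q!$$ and $$I_n(0,t)=\widetilde{I}_n(0,t) = A_n(t).$$
   Context: Trees. For $n\geq 0$, $\mathrm{Tree}(n+1)$ denotes the set of (labeled, unordered) trees on the vertex set $\{0,1,\ldots,n\}$. Each $T\in\mathrm{Tree}(n+1)$ is regarded as rooted at the vertex $0$. An inversion of $T$ is a pair $(i,j)$ with $1\leq i<j\leq n$ such that $j$ lies on the unique path from $i$ to the root $0$; $\mathrm{inv}(T)$ is the number of inversions of $T$. $\mathrm{lev}(T)$ is the number of leaves of $T$, where a leaf is a vertex having no children in the rooted tree (so for $n\geq 1$ the root $0$ is never counted as a leaf, even if it has degree $1$; for $n=0$ the single vertex $0$ is a leaf). Parking functions. For $n\geq 0$, a parking function of length $n$ is a sequence $\pi=(\pi_1,\ldots,\pi_n)$ of $n$ positive integers whose weakly increasing rearrangement $\pi_{i_1}\leq \pi_{i_2}\leq\cdots\leq \pi_{i_n}$ satisfies $\pi_{i_j}\leq j$ for all $1\leq j\leq n$. $\mathrm{PF}(n)$ is the set of parking functions of length $n$. For $\pi\in\mathrm{PF}(n)$, $\mathrm{cosum}(\pi):=\binom{n+1}{2}-\sum_{i=1}^n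 \pi_i$, and $\mathrm{exced}(\pi)$ is the number of indices $1\leq i\leq n$ such that $\pi_i>i$ (strict excedances). Notation. $[k]_q=1+q+\cdots+q^{k-1}$ and $[n]_q!=[n]_q[n-1]_q\cdots[1]_q$ (with $[0]_q!=1$). The Eulerian polynomial is $A_n(t)=\sum_{\sigma\in S_n}t^{\mathrm{des}(\sigma)}$, where $S_n$ is the symmetric group on $\{1,\ldots,n\}$ and $\mathrm{des}(\sigma)$ is the number of descents of $\sigma=\sigma_1\cdots\sigma_n$, i.e. of indices $1\leq i\leq n-1$ with $\sigma_i>\sigma_{i+1}$ (so $A_0(t)=1$). *)

theory Defs
  imports
    "HOL-Computational_Algebra.Polynomial"
    "HOL-Combinatorics.Permutations"
begin

text \<open>
  A simple graph on the vertex set \<open>{0, \<dots>, m - 1}\<close> is represented by its set of edges,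
  each edge being a two-element set of vertices.
\<close>

definition is_path :: "nat set set \<Rightarrow> nat \<Rightarrow> nat list \<Rightarrow> nat \<Rightarrow> bool" where
  "is_path E u p v \<longleftrightarrow>
     p \<noteq> [] \<and> hd p = u \<and> last p = v \<and> distinct p \<and> successively (\<lambda>x y. {x, y} \<in> E) p"

definition is_cycle :: "nat set set \<Rightarrow> nat list \<Rightarrow> bool" where
  "is_cycle E c \<longleftrightarrow>
     length c \<ge> 3 \<and> distinct c \<and> successively (\<lambda>x y. {x, y} \<in> E) c \<and> {last c, hd c} \<in> E"

definition Tree :: "nat \<Rightarrow> nat set set set" where
  "Tree m = {E. E \<subseteq> {e. e \<subseteq> {..<m} \<and> card e = 2} \<and>
                (\<forall>u<m. \<forall>v<m. \<exists>p. is_path E u p v) \<and>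
                (\<nexists>c. is_cycle E c)}"

lemma finite_Tree: "finite (Tree m)"
proof -
  have "Tree m \<subseteq> Pow (Pow {..<m})"
    by (auto simp: Tree_def)
  then show ?thesis
    by (rule finite_subset) simp
qed

text \<open>
  All trees are rooted at \<open>0\<close>. As the path from \<open>i\<close> to \<open>0\<close> in a tree exists and is unique,
  the following says that \<open>j\<close> lies on the path from \<open>i\<close> to the root.
\<close>

definition on_root_path :: "nat set set \<Rightarrow> nat \<Rightarrow> nat \<Rightarrow> bool" where
  "on_root_path E i j \<longleftrightarrow> (\<exists>p. is_path E i p 0 \<and> j \<in> set p)"

definition is_child :: "nat set set \<Rightarrow> nat \<Rightarrow> nat \<Rightarrow> bool" where
  "is_child E w v \<longleftrightarrow> {v, w} \<in> E \<and> on_root_path E w v"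

definition tree_inv :: "nat \<Rightarrow> nat set set \<Rightarrow> nat" where
  "tree_inv m E = card {(i, j). 1 \<le> i \<and> i < j \<and> j < m \<and> on_root_path E i j}"

definition tree_lev :: "nat \<Rightarrow> nat set set \<Rightarrow> nat" where
  "tree_lev m E = card {v. v < m \<and> (\<nexists>w. is_child E w v)}"

text \<open>Lists are indexed from \<open>0\<close>, so \<open>\<pi>\<^sub>i\<close> is \<open>xs ! (i - 1)\<close>.\<close>

definition PF :: "nat \<Rightarrow> nat list set" where
  "PF n = {xs. length xs = n \<and> (\<forall>x\<in>set xs. 1 \<le> x) \<and> (\<forall>j\<in>{1..n}. sort xs ! (j - 1) \<le> j)}"

lemma finite_PF: "finite (PF n)"
proof -
  have "PF n \<subseteq> {xs. set xs \<subseteq> {..n} \<and> length xs = n}"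
  proof safe
    fix xs x assume *: "xs \<in> PF n" and "x \<in> set xs"
    then have "x \<in> set (sort xs)" by simp
    then obtain k where k: "k < length xs" "x = sort xs ! k"
      by (metis in_set_conv_nth length_sort)
    then have "Suc k \<in> {1..n}" using * by (auto simp: PF_def)
    moreover have "\<forall>j\<in>{1..n}. sort xs ! (j - 1) \<le> j" using * by (simp add: PF_def)
    ultimately have "sort xs ! k \<le> Suc k" by (metis diff_Suc_1)
    with k * show "x \<le> n" by (auto simp: PF_def)
  qed (auto simp: PF_def)
  then show ?thesis
    by (rule finite_subset) (simp add: finite_lists_length_eq)
qed

definition cosum :: "nat list \<Rightarrow> nat" where
  "cosum xs = (length xs + 1 choose 2) - sum_list xs"

text \<open>The subtraction in \<open>cosum\<close> does not truncate on parking functions:\<close>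

lemma PF_sum_list_le:
  assumes "xs \<in> PF n"
  shows "sum_list xs \<le> (n + 1 choose 2)"
proof -
  have len: "length xs = n" and le: "\<And>j. j \<in> {1..n} \<Longrightarrow> sort xs ! (j - 1) \<le> j"
    using assms by (auto simp: PF_def)
  have "sum_list xs = sum_list (sort xs)"
    by (metis mset_sort sum_mset_sum_list)
  also have "\<dots> = (\<Sum>k<n. sort xs ! k)"
    by (simp add: sum_list_sum_nth len atLeast0LessThan)
  also have "\<dots> \<le> (\<Sum>k<n. Suc k)"
  proof (rule sum_mono)
    fix k assume "k \<in> {..<n}"
    then show "sort xs ! k \<le> Suc k" using le[of "Suc k"] by simp
  qed
  also have "\<dots> = (n + 1 choose 2)"
    by (induction n) (auto simp: numeral_2_eq_2)
  finally show ?thesis .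
qed

definition exced :: "nat list \<Rightarrow> nat" where
  "exced xs = card {i \<in> {1..length xs}. xs ! (i - 1) > i}"

text \<open>
  Polynomials in \<open>q\<close> have type \<open>int poly\<close>. Polynomials in \<open>q\<close> and \<open>t\<close> have type
  \<open>int poly poly\<close>: the outer variable is \<open>t\<close> and the coefficients are polynomials in \<open>q\<close>,
  so that \<open>monom (monom 1 a) b\<close> stands for \<open>q\<^sup>a t\<^sup>b\<close>.
\<close>

text \<open>
  A finite rooted tree has at least one leaf, so \<open>tree_lev (n + 1) T - 1\<close> below does not truncate.
\<close>

definition I_poly :: "nat \<Rightarrow> int poly poly" where
  "I_poly n = (\<Sum>T\<in>Tree (n + 1). monom (monom 1 (tree_inv (n + 1) T)) (tree_lev (n + 1) T - 1))"

definition I_tilde_poly :: "nat \<Rightarrow> int poly poly" where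
  "I_tilde_poly n = (\<Sum>xs\<in>PF n. monom (monom 1 (cosum xs)) (exced xs))"

definition subst_t_0 :: "int poly poly \<Rightarrow> int poly" where
  "subst_t_0 F = poly F 0"

definition subst_q_0 :: "int poly poly \<Rightarrow> int poly" where
  "subst_q_0 F = map_poly (\<lambda>c. poly c 0) F"

definition q_number :: "nat \<Rightarrow> int poly" where
  "q_number k = (\<Sum>i<k. monom 1 i)"

definition q_fact :: "nat \<Rightarrow> int poly" where
  "q_fact n = (\<Prod>k=1..n. q_number k)"

definition des :: "nat \<Rightarrow> (nat \<Rightarrow> nat) \<Rightarrow> nat" where
  "des n \<sigma> = card {i \<in> {1..n - 1}. \<sigma> i > \<sigma> (i + 1)}"

definition eulerian_poly :: "nat \<Rightarrow> int poly" where
  "eulerian_poly n = (\<Sum>\<sigma> | \<sigma> permutes {1..n}. monom 1 (des n \<sigma>))"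

end

theory Submission
  imports Defs "HOL-Combinatorics.Multiset_Permutations"
begin

text \<open>
  Setting \<open>t = 0\<close> keeps the trees with a single leaf and the parking functions without excedances.
  A tree with a single leaf is a path from the root, that is, a permutation, and its inversions are
  pairs of entries of that permutation; a parking function without excedances is any sequence with
  \<open>1 \<le> \<pi>\<^sub>i \<le> i\<close>. In both cases the \<open>n\<close>-th step of a construction by insertion contributes
  the factor \<open>[n]\<^sub>q\<close>.

  Setting \<open>q = 0\<close> keeps the increasing trees and the permutations. Each of the three families
  (increasing trees by leaves, permutations by excedances, permutations by descents) arises by inserting
  the largest label in \<open>n + 1\<close> ways, of which \<open>s + 1\<close> preserve the statistic \<open>s\<close> and the
  remaining \<open>n - s\<close> raise it by one, so all three satisfy the Eulerian recurrence
  \<open>A\<^sub>n\<^sub>+\<^sub>1 = (1 + n t) A\<^sub>n + t (1 - t) A\<^sub>n'\<close>.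
\<close>

subsection \<open>Trees and pendant vertices\<close>

text \<open>Arbitrary vertex sets are allowed because deleting a leaf from a tree on
  \<open>{..<m}\<close> need not leave an initial segment of the naturals.\<close>

definition tree_on :: "nat set \<Rightarrow> nat set set \<Rightarrow> bool" where
  "tree_on V E \<longleftrightarrow> E \<subseteq> {e. e \<subseteq> V \<and> card e = 2} \<and>
     (\<forall>u\<in>V. \<forall>v\<in>V. \<exists>p. is_path E u p v) \<and> (\<nexists>c. is_cycle E c)"

definition leaves :: "nat set \<Rightarrow> nat set set \<Rightarrow> nat set" where
  "leaves V E = {v \<in> V. \<nexists>w. is_child E w v}"

definition inversions :: "nat set \<Rightarrow> nat set set \<Rightarrow> (nat \<times> nat) set" where
  "inversions V E = {(i, j). 1 \<le> i \<and> i < j \<and> i \<in> V \<and> j \<in> V \<and> on_root_path E i j}"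

lemma Tree_iff_tree_on: "E \<in> Tree m \<longleftrightarrow> tree_on {..<m} E"
  by (auto simp: Tree_def tree_on_def)

lemma tree_on_path: "tree_on V E \<Longrightarrow> u \<in> V \<Longrightarrow> v \<in> V \<Longrightarrow> \<exists>p. is_path E u p v"
  by (simp add: tree_on_def)

lemma tree_lev_eq: "tree_lev m E = card (leaves {..<m} E)"
  by (simp add: tree_lev_def leaves_def)

lemma tree_inv_eq: "tree_inv m E = card (inversions {..<m} E)"
  unfolding tree_inv_def inversions_def by (rule arg_cong[of _ _ card]) auto

lemma finite_inversions: "finite V \<Longrightarrow> finite (inversions V E)"
  by (rule finite_subset[of _ "V \<times> V"]) (auto simp: inversions_def)

lemma is_path_commute: "is_path F u p x \<longleftrightarrow> is_path F x (rev p) u"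
  by (auto simp: is_path_def hd_rev last_rev successively_rev insert_commute)

text \<open>The predecessor and the successor on the path are distinct neighbours. The use is
  contrapositive: a vertex of degree one can only be an end of a path.\<close>

lemma interior_two_neighbours:
  assumes "distinct p" "successively (\<lambda>x y. {x, y} \<in> E) p" "w \<in> set p" "w \<noteq> hd p" "w \<noteq> last p"
  shows "\<exists>x y. x \<noteq> y \<and> {x, w} \<in> E \<and> {y, w} \<in> E"
proof -
  obtain as bs where p: "p = as @ w # bs" using assms(3) split_list by metis
  with assms have ne: "as \<noteq> []" "bs \<noteq> []" by auto
  then have "{last as, w} \<in> E" "{hd bs, w} \<in> E"
    using assms(2) p by (auto simp: successively_append_iff successively_Cons insert_commute)
  moreover have "last as \<noteq> hd bs"
    using assms(1) p ne by (metis IntI UnCI distinct_append empty_iff hd_in_set last_in_set list.set_intros(2))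
  ultimately show ?thesis by blast
qed

text \<open>The cyclic predecessor and successor serve; they differ because a cycle has at least
  three vertices. For the first and the last entry of the list one of the two edges is the closing
  edge.\<close>

lemma cycle_two_neighbours:
  assumes "is_cycle E c" "w \<in> set c"
  shows "\<exists>x y. x \<noteq> y \<and> {x, w} \<in> E \<and> {y, w} \<in> E"
proof -
  have c: "length c \<ge> 3" "distinct c" "successively (\<lambda>x y. {x, y} \<in> E) c" "{last c, hd c} \<in> E"
    using assms(1) by (auto simp: is_cycle_def)
  \<comment> \<open>\<open>remdups_adj.cases\<close> is borrowed for its case split into empty
    lists, singletons and lists with at least two entries.\<close>
  obtain a b p where ab: "c = a # b # p" "p \<noteq> []"
    using c(1) by (cases c rule: remdups_adj.cases) (auto simp: Suc_le_eq)
  consider "w = hd c" | "w = last c" | "w \<noteq> hd c" "w \<noteq> last c" by blast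
  then show ?thesis
  proof cases
    case 1
    have "b \<noteq> last p" using ab c(2) by auto
    moreover have "{b, w} \<in> E" "{last p, w} \<in> E"
      using 1 ab c by (auto simp: successively_Cons insert_commute)
    ultimately show ?thesis by blast
  next
    case 2
    obtain d q where p: "b # p = q @ [d, w]"
    proof -
      obtain r where r: "b # p = r @ [w]" using 2 ab by (metis append_butlast_last_id last_ConsR list.distinct(1))
      then have "r \<noteq> []" using ab by auto
      then obtain d q where "r = q @ [d]" by (metis rev_exhaust)
      with r that show ?thesis by simp
    qed
    have "a \<noteq> d" using ab c(2) p by (metis distinct.simps(2) in_set_conv_decomp)
    moreover have "{d, w} \<in> E"
      using c(3) ab p by (auto simp: successively_append_iff successively_Cons)
    moreover have "{a, w} \<in> E" using 2 ab c(4) by (auto simp: insert_commute)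
    ultimately show ?thesis by blast
  next
    case 3
    then show ?thesis using interior_two_neighbours[OF c(2,3) assms(2)] by blast
  qed
qed

text \<open>Only adjacency data is fixed here, so that \<open>tree_on_pendant\<close> can transfer
  being a tree in both directions; \<open>tree_pendant\<close> adds the tree and its root.\<close>

locale pendant =
  fixes V :: "nat set" and E :: "nat set set" and v w :: nat
  assumes edges: "E \<subseteq> {e. e \<subseteq> V \<and> card e = 2}" and v: "v \<in> V" and w: "w \<notin> V"
begin

abbreviation "E' \<equiv> insert {v, w} E"

lemma neighbour_w: "{x, w} \<in> E' \<longleftrightarrow> x = v"
  using edges w by (auto simp: doubleton_eq_iff)

lemma successively_avoiding:
  assumes "w \<notin> set p"
  shows "successively (\<lambda>x y. {x, y} \<in> E') p \<longleftrightarrow> successively (\<lambda>x y. {x, y} \<in> E) p"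
  using assms by (intro successively_cong refl) (auto simp: doubleton_eq_iff)

lemma is_path_pendant:
  assumes "i \<noteq> w" "j \<noteq> w"
  shows "is_path E' i p j \<longleftrightarrow> w \<notin> set p \<and> is_path E i p j"
proof -
  have "w \<notin> set p" if "is_path E' i p j"
  proof
    assume "w \<in> set p"
    then show False
      using interior_two_neighbours[of p E' w] that assms
      unfolding is_path_def neighbour_w by auto
  qed
  then show ?thesis using successively_avoiding by (auto simp: is_path_def)
qed

text \<open>The edges of \<open>E\<close> lie inside \<open>V\<close>, so \<open>w\<close> is
  isolated in \<open>E\<close> and can occur on a path only as its first vertex.\<close>

lemma path_avoids:
  assumes "is_path E i p j" "i \<noteq> w"
  shows "w \<notin> set p"
proof
  assume "w \<in> set p"
  then obtain as bs where p: "p = as @ w # bs" by (metis split_list)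
  with assms have "as \<noteq> []" by (auto simp: is_path_def)
  then have "{last as, w} \<in> E"
    using assms p by (auto simp: is_path_def successively_append_iff)
  then show False using edges w by auto
qed

text \<open>The first step out of \<open>w\<close> must go to its only neighbour \<open>v\<close>;
  \<open>j \<noteq> w\<close> excludes the one-vertex path.\<close>

lemma is_path_from_w:
  assumes "j \<noteq> w"
  shows "is_path E' w q j \<longleftrightarrow> (\<exists>p. q = w # p \<and> is_path E v p j)"
proof
  assume q: "is_path E' w q j"
  then obtain p where p: "q = w # p" by (cases q) (auto simp: is_path_def)
  with q assms have ne: "p \<noteq> []" by (auto simp: is_path_def)
  then have "{w, hd p} \<in> E'" "w \<notin> set p" using q p by (auto simp: is_path_def successively_Cons)
  then have "hd p = v" using neighbour_w by (metis insert_commute)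
  then show "\<exists>p. q = w # p \<and> is_path E v p j"
    using p q ne successively_avoiding[OF \<open>w \<notin> set p\<close>] by (auto simp: is_path_def successively_Cons)
next
  assume "\<exists>p. q = w # p \<and> is_path E v p j"
  then obtain p where p: "q = w # p" "is_path E v p j" by blast
  have "v \<noteq> w" using v w by auto
  then have "w \<notin> set p" using path_avoids p by blast
  then show "is_path E' w q j"
    using p successively_avoiding[OF \<open>w \<notin> set p\<close>] by (auto simp: is_path_def successively_Cons insert_commute)
qed

lemma is_cycle_pendant: "is_cycle E' c \<longleftrightarrow> is_cycle E c"
proof -
  have *: "w \<notin> set c" if "is_cycle E' c"
    using cycle_two_neighbours[OF that, of w] unfolding neighbour_w by auto
  have "is_cycle E c" if "is_cycle E' c"
  proof -
    \<comment> \<open>The closing edge does not occur among the consecutive pairs of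
      \<open>c\<close>, so it has to be kept apart from the new edge separately.\<close>
    have "hd c \<noteq> w" "last c \<noteq> w" using *[OF that] that by (auto simp: is_cycle_def) (metis hd_in_set last_in_set list.size(3) not_numeral_le_zero)+
    then show ?thesis using that successively_avoiding[OF *[OF that]]
      by (auto simp: is_cycle_def doubleton_eq_iff)
  qed
  moreover have "is_cycle E' c" if "is_cycle E c"
    using that by (auto simp: is_cycle_def elim: successively_mono)
  ultimately show ?thesis by blast
qed

text \<open>Paths between vertices of \<open>V\<close> and all cycles are the same in both graphs.
  Paths starting at \<open>w\<close> are paths from \<open>v\<close> with \<open>w\<close> put in
  front, and those ending at \<open>w\<close> are reversals.\<close>

lemma tree_on_pendant: "tree_on (insert w V) E' \<longleftrightarrow> tree_on V E"
proof
  assume t: "tree_on (insert w V) E'"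
  have "\<exists>p. is_path E a p b" if "a \<in> V" "b \<in> V" for a b
  proof -
    have "a \<noteq> w" "b \<noteq> w" using that w by auto
    moreover have "\<exists>p. is_path E' a p b" using tree_on_path[OF t, of a b] that by simp
    ultimately show ?thesis by (simp add: is_path_pendant) blast
  qed
  then show "tree_on V E" using t edges is_cycle_pendant by (auto simp: tree_on_def)
next
  assume t: "tree_on V E"
  have vw: "v \<noteq> w" using v w by auto
  have V: "\<exists>p. is_path E' a p b" if "a \<in> V" "b \<in> V" for a b
  proof -
    have "a \<noteq> w" "b \<noteq> w" using that w by auto
    moreover from that obtain p where p: "is_path E a p b" using tree_on_path[OF t] by blast
    ultimately show ?thesis using is_path_pendant path_avoids by blast
  qed
  have W: "\<exists>p. is_path E' w p b" if "b \<in> V" for b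
  proof -
    have "b \<noteq> w" using that w by auto
    moreover from that obtain p where p: "is_path E v p b" using tree_on_path[OF t] v by blast
    ultimately show ?thesis using is_path_from_w by blast
  qed
  have "is_path E' w [w] w" by (simp add: is_path_def)
  then have "\<forall>a\<in>insert w V. \<forall>b\<in>insert w V. \<exists>p. is_path E' a p b"
    using V W is_path_commute by (metis insert_iff)
  moreover have "E' \<subseteq> {e. e \<subseteq> insert w V \<and> card e = 2}" using edges v vw by auto
  ultimately show "tree_on (insert w V) E'" using t is_cycle_pendant by (simp add: tree_on_def)
qed

lemma on_root_path_pendant:
  assumes "w \<noteq> 0"
  shows "on_root_path E' i j \<longleftrightarrow>
    (if i = w then (\<exists>p. is_path E v p 0) \<and> j = w \<or> on_root_path E v j else j \<noteq> w \<and> on_root_path E i j)"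
proof (cases "i = w")
  case True
  then show ?thesis using assms by (auto simp: on_root_path_def is_path_from_w)
next
  case False
  then show ?thesis using assms path_avoids by (auto simp: on_root_path_def is_path_pendant)
qed

end

locale tree_pendant = pendant +
  assumes tree: "tree_on V E" and root: "0 \<in> V"
begin

lemma w_nonzero: "w \<noteq> 0" and v_neq_w: "v \<noteq> w"
  using root v w by metis+

lemma on_root_path_w: "on_root_path E' w j \<longleftrightarrow> j = w \<or> on_root_path E v j"
  using on_root_path_pendant[OF w_nonzero] tree root v by (auto simp: tree_on_def)

lemma on_root_path_other: "i \<noteq> w \<Longrightarrow> on_root_path E' i j \<longleftrightarrow> j \<noteq> w \<and> on_root_path E i j"
  using on_root_path_pendant[OF w_nonzero] by auto

lemma on_root_path_self: "i \<in> V \<Longrightarrow> on_root_path E i i"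
proof -
  assume "i \<in> V"
  then obtain p where "is_path E i p 0" using tree_on_path[OF tree] root by blast
  moreover from this have "i \<in> set p" by (auto simp: is_path_def)
  ultimately show "on_root_path E i i" by (auto simp: on_root_path_def)
qed

lemma on_root_path_not_w: "i \<noteq> w \<Longrightarrow> \<not> on_root_path E i w"
  using path_avoids by (auto simp: on_root_path_def)

text \<open>The only new parent-child pair is \<open>v\<close> with \<open>w\<close>. Hence the
  number of leaves stays the same if \<open>v\<close> was a leaf and grows by one otherwise.\<close>

lemma leaves_pendant: "leaves (insert w V) E' = insert w (leaves V E - {v})"
proof -
  have *: "is_child E' x y \<longleftrightarrow> is_child E x y \<or> x = w \<and> y = v" for x y
  proof (cases "x = w")
    case True
    have "\<not> is_child E w y" using edges w by (auto simp: is_child_def)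
    moreover have "is_child E' w v"
      using on_root_path_w on_root_path_self v by (auto simp: is_child_def)
    moreover have "y = v" if "is_child E' w y" using that neighbour_w by (auto simp: is_child_def)
    ultimately show ?thesis using True by blast
  next
    case False
    have "\<not> on_root_path E x w" using False on_root_path_not_w by blast
    then have "is_child E x y \<Longrightarrow> y \<noteq> w" by (auto simp: is_child_def)
    then show ?thesis using False on_root_path_other[of x y]
      by (auto simp: is_child_def doubleton_eq_iff)
  qed
  have "\<not> is_child E x w" for x using edges w by (auto simp: is_child_def)
  then show ?thesis using v_neq_w v w unfolding leaves_def * by auto
qed

text \<open>Root paths of old vertices do not change and \<open>w\<close> has nothing below it, so
  every new inversion has \<open>w\<close> as its first component.\<close>

lemma inversions_pendant:
  "inversions (insert w V) E' = inversions V E \<union> Pair w ` {j \<in> V. w < j \<and> on_root_path E v j}"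
proof -
  have "(a, b) \<in> inversions (insert w V) E' \<longleftrightarrow>
      (a, b) \<in> inversions V E \<or> a = w \<and> b \<in> V \<and> w < b \<and> on_root_path E v b" for a b
  proof (cases "a = w")
    case True
    then show ?thesis using w w_nonzero by (auto simp: inversions_def on_root_path_w)
  next
    case False
    then show ?thesis
      using w w_nonzero on_root_path_not_w[of a] by (auto simp: inversions_def on_root_path_other)
  qed
  then show ?thesis by auto
qed

end

text \<open>If \<open>u\<close> were already on \<open>p\<close>, the part of \<open>p\<close> from
  \<open>w\<close> to \<open>u\<close>, closed by the edge \<open>{u, w}\<close>, would be a cycle.
  The last hypothesis ensures that this part has at least three vertices.\<close>

lemma path_extend:
  assumes "is_path E w p z" "{u, w} \<in> E" "\<nexists>c. is_cycle E c" "u \<noteq> w" "length p \<ge> 2 \<Longrightarrow> u \<noteq> p ! 1"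
  shows "is_path E u (u # p) z"
proof -
  have "u \<notin> set p"
  proof
    assume "u \<in> set p"
    then obtain as bs where p: "p = as @ u # bs" by (metis split_list)
    with assms have "as \<noteq> []" by (auto simp: is_path_def)
    then obtain q where as: "as = w # q" using p assms by (cases as) (auto simp: is_path_def)
    with assms p have "q \<noteq> []" by auto
    then have "is_cycle E (w # q @ [u])"
      using assms p as by (cases q) (auto simp: is_cycle_def is_path_def successively_append_iff successively_Cons hd_append)
    then show False using assms by blast
  qed
  then show ?thesis using assms by (auto simp: is_path_def successively_Cons)
qed

lemma edge_neq: "E \<subseteq> {e. e \<subseteq> V \<and> card e = 2} \<Longrightarrow> {u, w} \<in> E \<Longrightarrow> u \<noteq> (w :: nat)"
  by auto

text \<open>Inverse to attaching: a vertex of degree one lies on a single edge, so deleting it puts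
  the graph into the form to which \<open>tree_on_pendant\<close> applies.\<close>

lemma remove_pendant:
  assumes t: "tree_on (insert w V) E" and w: "w \<notin> V" and nb: "\<And>u. {u, w} \<in> E \<longleftrightarrow> u = v"
  defines "F \<equiv> {e \<in> E. w \<notin> e}"
  shows "v \<in> V" "E = insert {v, w} F" "pendant V F v w" "tree_on V F"
proof -
  have E: "E \<subseteq> {e. e \<subseteq> insert w V \<and> card e = 2}" using t by (auto simp: tree_on_def)
  have "{v, w} \<in> E" using nb by blast
  then show v: "v \<in> V" using E edge_neq[OF E] by blast
  have "e = {v, w}" if e: "e \<in> E" "w \<in> e" for e
  proof -
    have "card e = 2" using e E by auto
    then obtain x y where xy: "e = {x, y}" by (auto simp: card_2_iff)
    with e have "e = {x, w} \<or> e = {y, w}" by auto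
    then have "{x, w} \<in> E \<and> e = {x, w} \<or> {y, w} \<in> E \<and> e = {y, w}" using e by blast
    then show ?thesis unfolding nb by blast
  qed
  then have "e \<in> E \<longleftrightarrow> e = {v, w} \<or> e \<in> F" for e using \<open>{v, w} \<in> E\<close> unfolding F_def by blast
  then show eq: "E = insert {v, w} F" by blast
  have "F \<subseteq> {e. e \<subseteq> V \<and> card e = 2}" using E by (auto simp: F_def)
  then show "pendant V F v w" using v w by (simp add: pendant_def)
  then show "tree_on V F" using t eq pendant.tree_on_pendant by metis
qed

subsection \<open>Trees with a single leaf\<close>

text \<open>
  A list is read from the leaf towards the root, which is left implicit: \<open>hd (xs @ [0])\<close> is the
  first entry of \<open>xs\<close>, or the root \<open>0\<close> if \<open>xs\<close> is empty.
\<close>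

fun list_tree :: "nat list \<Rightarrow> nat set set" where
  "list_tree [] = {}"
| "list_tree (x # xs) = insert {hd (xs @ [0]), x} (list_tree xs)"

text \<open>Increasing pairs are counted, not decreasing ones: the list runs from the leaf to the
  root, and a tree inversion has its larger label nearer the root.\<close>

fun list_inv :: "nat list \<Rightarrow> nat" where
  "list_inv [] = 0"
| "list_inv (x # xs) = card {y \<in> set xs. x < y} + list_inv xs"

lemma tree_on_singleton: "tree_on {v} E \<longleftrightarrow> E = {}"
proof
  assume t: "tree_on {v} E"
  have "e \<notin> E" for e
  proof
    assume "e \<in> E"
    then have "e \<subseteq> {v}" "card e = 2" using t by (auto simp: tree_on_def)
    then show False using card_mono[of "{v}" e] by simp
  qed
  then show "E = {}" by auto
next
  have "is_path {} v [v] v" by (simp add: is_path_def)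
  moreover have "\<not> is_cycle {} c" for c by (simp add: is_cycle_def)
  ultimately show "E = {} \<Longrightarrow> tree_on {v} E" by (auto simp: tree_on_def)
qed

lemma on_root_path_empty [simp]: "on_root_path {} i j \<longleftrightarrow> i = 0 \<and> j = 0"
proof -
  have "is_path {} i p 0 \<longleftrightarrow> i = 0 \<and> p = [0]" for p
    by (cases p rule: remdups_adj.cases) (auto simp: is_path_def)
  then show ?thesis by (auto simp: on_root_path_def)
qed

lemma leaves_empty: "leaves V {} = V"
  by (auto simp: leaves_def is_child_def)

lemma inversions_empty: "inversions V {} = {}"
  by (auto simp: inversions_def)

text \<open>Induction, attaching \<open>x\<close> at the former leaf. The third property feeds the
  fourth: all earlier vertices lie on the root path of that leaf, so each of them exceeding
  \<open>x\<close> gives one new inversion.\<close>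

lemma list_tree_properties:
  assumes "distinct xs" "0 \<notin> set xs"
  defines "V \<equiv> insert 0 (set xs)"
  shows "tree_on V (list_tree xs)" "leaves V (list_tree xs) = {hd (xs @ [0])}"
    "{j. on_root_path (list_tree xs) (hd (xs @ [0])) j} = V"
    "card (inversions V (list_tree xs)) = list_inv xs"
proof -
  have "tree_on V (list_tree xs) \<and> leaves V (list_tree xs) = {hd (xs @ [0])} \<and>
    {j. on_root_path (list_tree xs) (hd (xs @ [0])) j} = V \<and>
    card (inversions V (list_tree xs)) = list_inv xs"
    unfolding V_def using assms(1,2)
  proof (induction xs)
    case Nil
    then show ?case by (simp add: tree_on_singleton leaves_empty inversions_empty)
  next
    case (Cons x xs)
    let ?V = "insert 0 (set xs)" and ?E = "list_tree xs" and ?v = "hd (xs @ [0])"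
    have IH: "tree_on ?V ?E" "leaves ?V ?E = {?v}" "{j. on_root_path ?E ?v j} = ?V"
      "card (inversions ?V ?E) = list_inv xs" using Cons by auto
    interpret tree_pendant ?V ?E ?v x
      using Cons.prems IH(1) by unfold_locales (auto simp: tree_on_def hd_append)
    have V: "insert 0 (set (x # xs)) = insert x ?V" by auto
    have j: "{j \<in> ?V. x < j \<and> on_root_path ?E ?v j} = {j \<in> set xs. x < j}"
      using IH(3) by auto
    have "inversions ?V ?E \<inter> Pair x ` {j \<in> set xs. x < j} = {}"
      using Cons.prems by (auto simp: inversions_def)
    moreover have "inversions (insert x ?V) (list_tree (x # xs)) =
      inversions ?V ?E \<union> Pair x ` {j \<in> set xs. x < j}"
      using inversions_pendant by (simp only: j list_tree.simps)
    ultimately have "card (inversions (insert x ?V) (list_tree (x # xs))) = list_inv (x # xs)"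
      using IH(4) by (simp add: finite_inversions card_Un_disjoint card_image inj_on_def)
    then show ?case unfolding V
      using tree_on_pendant IH leaves_pendant on_root_path_w by auto
  qed
  then show "tree_on V (list_tree xs)" "leaves V (list_tree xs) = {hd (xs @ [0])}"
    "{j. on_root_path (list_tree xs) (hd (xs @ [0])) j} = V"
    "card (inversions V (list_tree xs)) = list_inv xs" by blast+
qed

text \<open>The head of a nonempty list is the only leaf of its tree, and discarding the edges at
  that leaf leaves the tree of the tail.\<close>

lemma list_tree_inj:
  assumes "distinct xs" "0 \<notin> set xs" "distinct ys" "0 \<notin> set ys" "set xs = set ys"
    "list_tree xs = list_tree ys"
  shows "xs = ys"
  using assms
proof (induction xs arbitrary: ys)
  case Nil
  then show ?case by simp
next
  case (Cons x xs)
  have "ys \<noteq> []" using Cons.prems(5) by auto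
  then obtain y ys' where ys: "ys = y # ys'" using list.exhaust by blast
  have "{hd ((x # xs) @ [0])} = {hd (ys @ [0])}"
    using list_tree_properties(2)[of "x # xs"] list_tree_properties(2)[of ys] Cons.prems by metis
  then have y: "y = x" using ys by simp
  have set: "set xs = set ys'" using Cons.prems ys y by auto
  have *: "list_tree zs = {e \<in> list_tree (x # zs). x \<notin> e}" if "distinct (x # zs)" "0 \<notin> set (x # zs)" for zs
  proof -
    have "tree_on (insert 0 (set zs)) (list_tree zs)" using list_tree_properties(1) that by auto
    then have "\<forall>e\<in>list_tree zs. x \<notin> e" using that by (auto simp: tree_on_def)
    then show ?thesis by auto
  qed
  have "list_tree xs = list_tree ys'"
    using *[of xs] *[of ys'] Cons.prems unfolding ys y by metis
  then show ?case using Cons ys y set by simp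
qed

text \<open>The far end of a longest path to the root has no neighbour but the next vertex on the path.\<close>

lemma exists_pendant_vertex:
  assumes t: "tree_on V E" and fin: "finite V" and root: "0 \<in> V" and ne: "V \<noteq> {0}"
  obtains v w where "w \<in> V" "w \<noteq> 0" "\<And>u. {u, w} \<in> E \<longleftrightarrow> u = v"
proof -
  have E: "E \<subseteq> {e. e \<subseteq> V \<and> card e = 2}" and acyc: "\<nexists>c. is_cycle E c"
    using t by (auto simp: tree_on_def)
  define L where "L = {p. \<exists>w\<in>V. is_path E w p 0}"
  have sub: "set p \<subseteq> V" if "is_path E w p 0" "w \<in> V" for w p
  proof
    fix x assume "x \<in> set p"
    show "x \<in> V"
    proof (cases "x = w")
      case False
      obtain as bs where p: "p = as @ x # bs" using \<open>x \<in> set p\<close> by (metis split_list)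
      with False that have "as \<noteq> []" by (auto simp: is_path_def)
      then have "{last as, x} \<in> E" using that p by (auto simp: is_path_def successively_append_iff)
      then show ?thesis using E by auto
    qed (use that in simp)
  qed
  have "length p \<le> card V" if "p \<in> L" for p
  proof -
    from that obtain w where "w \<in> V" "is_path E w p 0" by (auto simp: L_def)
    then show ?thesis using card_mono[OF fin sub] by (metis distinct_card is_path_def)
  qed
  then have bound: "\<forall>p. p \<in> L \<longrightarrow> length p < Suc (card V)" by (simp add: less_Suc_eq_le)
  obtain x where x: "x \<in> V" "x \<noteq> 0" using ne root by auto
  obtain q where q: "is_path E x q 0" using tree_on_path[OF t x(1) root] by blast
  have "q \<in> L" using q x by (auto simp: L_def)
  then obtain p where p: "p \<in> L" and longest: "\<forall>r. r \<in> L \<longrightarrow> length r \<le> length p"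
    using ex_has_greatest_nat[of "\<lambda>p. p \<in> L" q length, OF _ bound] by blast
  obtain w where w: "w \<in> V" "is_path E w p 0" using p by (auto simp: L_def)
  \<comment> \<open>A vertex other than the root has a path of at least two vertices, so a longest
    path has a second vertex \<open>v\<close>.\<close>
  have "length q \<ge> 2" using q x by (cases q rule: remdups_adj.cases) (auto simp: is_path_def)
  then have "length p \<ge> 2" using longest \<open>q \<in> L\<close> by force
  then obtain v r where pv: "p = w # v # r"
    using w by (cases p rule: remdups_adj.cases) (auto simp: is_path_def)
  have "0 \<in> set (v # r)" using w pv last_in_set[of "v # r"] by (simp add: is_path_def)
  then have "w \<noteq> 0" using w pv by (auto simp: is_path_def intro!: gr0I)
  moreover have "u = v" if u: "{u, w} \<in> E" for u
  proof (rule ccontr)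
    assume "u \<noteq> v"
    then have "is_path E u (u # p) 0"
      using path_extend[OF w(2) u acyc edge_neq[OF E u]] pv by simp
    moreover have "u \<in> V" using u E by auto
    ultimately have "u # p \<in> L" by (auto simp: L_def)
    then show False using longest by fastforce
  qed
  moreover have "{v, w} \<in> E" using w pv by (auto simp: is_path_def insert_commute)
  ultimately show ?thesis using that[of w v] w by metis
qed

text \<open>Remove a pendant vertex \<open>w\<close> attached at \<open>v\<close>. As
  \<open>w\<close> is a leaf, it is the only one, so the smaller tree has no leaf except possibly
  \<open>v\<close>, and the induction hypothesis gives a list in front of which \<open>w\<close> can
  be put.\<close>

lemma list_tree_surj:
  assumes "tree_on V E" "finite V" "0 \<in> V" "card (leaves V E) \<le> 1"
  shows "\<exists>xs. distinct xs \<and> 0 \<notin> set xs \<and> V = insert 0 (set xs) \<and> E = list_tree xs"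
  using assms
proof (induction "card V" arbitrary: V E)
  case 0
  then show ?case by auto
next
  case (Suc n)
  show ?case
  proof (cases "V = {0}")
    case True
    then have "E = list_tree []" using Suc.prems(1) by (simp add: tree_on_singleton)
    then show ?thesis using True by (intro exI[of _ "[]"]) auto
  next
    case False
    then obtain v w where w: "w \<in> V" "w \<noteq> 0" "\<And>u. {u, w} \<in> E \<longleftrightarrow> u = v"
      using exists_pendant_vertex Suc.prems by metis
    define U F where "U = V - {w}" and "F = {e \<in> E. w \<notin> e}"
    have V: "V = insert w U" "w \<notin> U" using w by (auto simp: U_def)
    have *: "v \<in> U" "E = insert {v, w} F" "pendant U F v w" "tree_on U F"
      using remove_pendant[of w U E v] Suc.prems(1) V w(3) unfolding F_def by blast+
    have U: "finite U" "0 \<in> U" "card U = n" using Suc w by (auto simp: U_def)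
    interpret pendant U F v w by (rule *)
    interpret tree_pendant U F v w using * U by unfold_locales
    have lv: "leaves V E = insert w (leaves U F - {v})" using leaves_pendant V(1) *(2) by simp
    have fin: "finite (leaves U F)" using U by (simp add: leaves_def)
    have "w \<notin> leaves U F" using V by (auto simp: leaves_def)
    then have "card (leaves U F - {v}) = 0" using Suc.prems(4) fin lv by simp
    then have sub: "leaves U F \<subseteq> {v}" using fin by simp
    then have "card (leaves U F) \<le> 1" using card_mono[of "{v}"] by fastforce
    then obtain xs where xs: "distinct xs" "0 \<notin> set xs" "U = insert 0 (set xs)" "F = list_tree xs"
      using Suc.hyps(1)[of U F] * U by auto
    \<comment> \<open>The tree of a list does have a leaf, so the inclusion \<open>sub\<close> now
      identifies \<open>v\<close> as the head of that list.\<close>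
    then have "leaves U F = {hd (xs @ [0])}" using list_tree_properties(2) by simp
    then have "v = hd (xs @ [0])" using sub by simp
    then have "E = list_tree (w # xs)" using *(2) xs by simp
    moreover have "distinct (w # xs)" "0 \<notin> set (w # xs)" using xs V w by auto
    moreover have "V = insert 0 (set (w # xs))" using V xs by auto
    ultimately show ?thesis by blast
  qed
qed

subsection \<open>Increasing trees\<close>

definition increasing_trees :: "nat \<Rightarrow> nat set set set" where
  "increasing_trees n = {T \<in> Tree (n + 1). tree_inv (n + 1) T = 0}"

lemma increasing_trees_iff:
  "T \<in> increasing_trees n \<longleftrightarrow> tree_on {..n} T \<and> inversions {..n} T = {}"
  by (auto simp: increasing_trees_def Tree_iff_tree_on tree_inv_eq lessThan_Suc_atMost finite_inversions)

lemma increasing_trees_0: "increasing_trees 0 = {{}}"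
  by (auto simp: increasing_trees_iff tree_on_singleton inversions_empty)

lemma increasing_tree_pendant:
  assumes "T \<in> increasing_trees n" "v \<le> n"
  shows "tree_pendant {..n} T v (Suc n)"
  using assms by unfold_locales (auto simp: increasing_trees_iff tree_on_def)

text \<open>The largest label can hang from any of the \<open>n + 1\<close> vertices without
  creating an inversion. Conversely it has no child in an increasing tree, hence is pendant and can
  be removed.\<close>

lemma bij_betw_increasing_trees:
  "bij_betw (\<lambda>(T, v). insert {v, Suc n} T) (increasing_trees n \<times> {..n}) (increasing_trees (Suc n))"
  unfolding bij_betw_def
proof
  \<comment> \<open>For injectivity, \<open>T\<close> and \<open>v\<close> are recovered from the
    image: the edges avoiding \<open>Suc n\<close>, and the only neighbour of
    \<open>Suc n\<close>.\<close>
  have *: "T = {e \<in> insert {v, Suc n} T. Suc n \<notin> e} \<and> (\<forall>u. {u, Suc n} \<in> insert {v, Suc n} T \<longleftrightarrow> u = v)"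
    if "T \<in> increasing_trees n" "v \<le> n" for T v
  proof -
    interpret tree_pendant "{..n}" T v "Suc n" using increasing_tree_pendant that by blast
    have "\<forall>e\<in>T. Suc n \<notin> e" using w edges by blast
    then show ?thesis using neighbour_w by auto
  qed
  show "inj_on (\<lambda>(T, v). insert {v, Suc n} T) (increasing_trees n \<times> {..n})"
  proof (rule inj_onI, clarify)
    fix T v S u assume T: "T \<in> increasing_trees n" "v \<le> n" and S: "S \<in> increasing_trees n" "u \<le> n"
      and eq: "insert {v, Suc n} T = insert {u, Suc n} S"
    define X where "X = insert {u, Suc n} S"
    have "T = {e \<in> X. Suc n \<notin> e} \<and> (\<forall>x. {x, Suc n} \<in> X \<longleftrightarrow> x = v)"
      unfolding X_def eq[symmetric] by (rule *[OF T])
    moreover have "S = {e \<in> X. Suc n \<notin> e} \<and> (\<forall>x. {x, Suc n} \<in> X \<longleftrightarrow> x = u)"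
      unfolding X_def by (rule *[OF S])
    ultimately show "T = S \<and> v = u" by metis
  qed
  have "insert {v, Suc n} T \<in> increasing_trees (Suc n)" if T: "T \<in> increasing_trees n" "v \<le> n" for T v
  proof -
    interpret tree_pendant "{..n}" T v "Suc n" using increasing_tree_pendant that by blast
    show ?thesis using T tree_on_pendant inversions_pendant by (auto simp: increasing_trees_iff atMost_Suc)
  qed
  moreover have "\<exists>T\<in>increasing_trees n. \<exists>v\<le>n. S = insert {v, Suc n} T" if S: "S \<in> increasing_trees (Suc n)" for S
  proof -
    have t: "tree_on (insert (Suc n) {..n}) S" and inv: "inversions {..Suc n} S = {}"
      using S by (auto simp: increasing_trees_iff atMost_Suc)
    have E: "S \<subseteq> {e. e \<subseteq> {..Suc n} \<and> card e = 2}" and acyc: "\<nexists>c. is_cycle S c"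
      using t by (auto simp: tree_on_def atMost_Suc)
    obtain p where p: "is_path S (Suc n) p 0" using tree_on_path[OF t] by blast
    then obtain v r where pv: "p = Suc n # v # r"
      by (cases p rule: remdups_adj.cases) (auto simp: is_path_def)
    \<comment> \<open>A neighbour other than the next vertex on the root path would be a child of
      \<open>Suc n\<close> with a smaller label, that is, an inversion.\<close>
    have "u = v" if u: "{u, Suc n} \<in> S" for u
    proof (rule ccontr)
      assume "u \<noteq> v"
      then have path: "is_path S u (u # p) 0"
        using path_extend[OF p u acyc edge_neq[OF E u]] pv by simp
      have "0 \<in> set p" using p last_in_set[of p] by (auto simp: is_path_def)
      then have "u \<noteq> 0" using path by (auto simp: is_path_def intro!: gr0I)
      moreover have "u \<le> n" using u E edge_neq[OF E u] by auto
      moreover have "on_root_path S u (Suc n)" using path pv by (auto simp: on_root_path_def)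
      ultimately have "(u, Suc n) \<in> inversions {..Suc n} S" by (auto simp: inversions_def)
      then show False using inv by simp
    qed
    moreover have "{v, Suc n} \<in> S" using p pv by (auto simp: is_path_def insert_commute)
    ultimately have nb: "\<And>u. {u, Suc n} \<in> S \<longleftrightarrow> u = v" by blast
    define T where "T = {e \<in> S. Suc n \<notin> e}"
    have *: "v \<in> {..n}" "S = insert {v, Suc n} T" "pendant {..n} T v (Suc n)" "tree_on {..n} T"
      using remove_pendant[OF t _ nb] unfolding T_def by auto
    interpret pendant "{..n}" T v "Suc n" by (rule *)
    interpret tree_pendant "{..n}" T v "Suc n" using * by unfold_locales auto
    have "inversions {..n} T = {}" using inversions_pendant inv *(2) by (simp add: atMost_Suc)
    then show ?thesis using * by (auto simp: increasing_trees_iff)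
  qed
  ultimately show "(\<lambda>(T, v). insert {v, Suc n} T) ` (increasing_trees n \<times> {..n}) = increasing_trees (Suc n)"
    by force
qed

subsection \<open>Specialisations of polynomials in two variables\<close>

lemma subst_t_0_sum:
  assumes "finite S"
  shows "subst_t_0 (\<Sum>x\<in>S. monom (monom 1 (f x)) (g x)) = (\<Sum>x | x \<in> S \<and> g x = 0. monom 1 (f x))"
proof -
  have "poly (monom c b) 0 = (if b = 0 then c else 0)" for c :: "int poly" and b
    by (simp add: poly_monom power_0_left)
  then show ?thesis
    using assms by (simp add: subst_t_0_def poly_sum sum.inter_filter)
qed

lemma subst_q_0_sum:
  assumes "finite S"
  shows "subst_q_0 (\<Sum>x\<in>S. monom (monom 1 (f x)) (g x)) = (\<Sum>x | x \<in> S \<and> f x = 0. monom 1 (g x))"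
proof -
  have add: "subst_q_0 (p + q) = subst_q_0 p + subst_q_0 q" for p q
    by (intro poly_eqI) (simp add: subst_q_0_def coeff_map_poly)
  have zero: "subst_q_0 0 = 0" by (simp add: subst_q_0_def)
  have mon: "subst_q_0 (monom (monom 1 a) b) = (if a = 0 then monom 1 b else 0)" for a b
    by (simp add: subst_q_0_def map_poly_monom poly_monom power_0_left)
  have "subst_q_0 (\<Sum>x\<in>S. monom (monom 1 (f x)) (g x)) =
      (\<Sum>x\<in>S. subst_q_0 (monom (monom 1 (f x)) (g x)))"
    using assms by (induction S rule: finite_induct) (simp_all add: add zero)
  then show ?thesis using assms by (simp add: mon sum.inter_filter)
qed

subsection \<open>Permutations as lists\<close>

abbreviation perms :: "nat \<Rightarrow> nat list set" where
  "perms n \<equiv> permutations_of_set {1..n}"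

lemma perms_D:
  assumes "xs \<in> perms n"
  shows "length xs = n" "set xs = {1..n}" "distinct xs"
  using assms length_finite_permutations_of_set[OF assms] by (auto dest: permutations_of_setD)

text \<open>Both sides have \<open>(n + 1)!\<close> elements, so an injection is onto.\<close>

lemma bij_betw_perms_Suc:
  assumes inj: "inj_on f (perms n \<times> {..n})" and "f ` (perms n \<times> {..n}) \<subseteq> perms (Suc n)"
  shows "bij_betw f (perms n \<times> {..n}) (perms (Suc n))"
proof -
  have "card (f ` (perms n \<times> {..n})) = card (perms (Suc n))"
    unfolding card_image[OF inj] by (simp add: card_cartesian_product)
  then show ?thesis using assms card_subset_eq[of "perms (Suc n)"] by (simp add: bij_betw_def)
qed

definition insert_max :: "nat list \<times> nat \<Rightarrow> nat list" where
  "insert_max = (\<lambda>(xs, k). take k xs @ Suc (length xs) # drop k xs)"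

lemma bij_betw_insert_max: "bij_betw insert_max (perms n \<times> {..n}) (perms (Suc n))"
proof (rule bij_betw_perms_Suc)
  \<comment> \<open>The entries before the maximum determine \<open>k\<close>, and deleting the
    maximum gives back \<open>xs\<close>.\<close>
  have *: "takeWhile (\<lambda>x. x \<noteq> Suc n) (insert_max (xs, k)) = take k xs \<and>
      filter (\<lambda>x. x \<noteq> Suc n) (insert_max (xs, k)) = xs" if "xs \<in> perms n" for xs k
  proof -
    have "x \<noteq> Suc n" if "x \<in> set (take k xs) \<or> x \<in> set (drop k xs)" for x
      using that perms_D[OF \<open>xs \<in> perms n\<close>] by (auto dest!: in_set_takeD in_set_dropD)
    then have "takeWhile (\<lambda>x. x \<noteq> Suc n) (take k xs) = take k xs"
      "filter (\<lambda>x. x \<noteq> Suc n) (take k xs) = take k xs" "filter (\<lambda>x. x \<noteq> Suc n) (drop k xs) = drop k xs"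
      "\<forall>x\<in>set (take k xs). x \<noteq> Suc n"
      by (simp_all add: takeWhile_eq_all_conv filter_id_conv)
    then show ?thesis using perms_D[OF that] by (simp add: insert_max_def takeWhile_append)
  qed
  show "inj_on insert_max (perms n \<times> {..n})"
  proof (rule inj_onI, clarify)
    fix xs k ys j assume "xs \<in> perms n" "k \<le> n" "ys \<in> perms n" "j \<le> n"
      and eq: "insert_max (xs, k) = insert_max (ys, j)"
    then have "take k xs = take j ys" "xs = ys"
      using *[of xs k] *[of ys j] by metis+
    moreover have "length (take k xs) = k" "length (take j ys) = j"
      using perms_D(1)[OF \<open>xs \<in> perms n\<close>] perms_D(1)[OF \<open>ys \<in> perms n\<close>] \<open>k \<le> n\<close> \<open>j \<le> n\<close> by auto
    ultimately show "xs = ys \<and> k = j" by metis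
  qed
  show "insert_max ` (perms n \<times> {..n}) \<subseteq> perms (Suc n)"
  proof clarify
    fix xs k assume xs: "xs \<in> perms n"
    have "mset (insert_max (xs, k)) = mset (Suc n # xs)"
      using perms_D(1)[OF xs] by (simp add: insert_max_def) (metis append_take_drop_id mset_append)
    then have "set (insert_max (xs, k)) = set (Suc n # xs)" "distinct (insert_max (xs, k))"
      using perms_D[OF xs] by (metis mset_eq_setD, subst mset_eq_imp_distinct_iff[of _ "Suc n # xs"], auto)
    then show "insert_max (xs, k) \<in> perms (Suc n)"
      using perms_D[OF xs] by (auto simp: permutations_of_set_def)
  qed
qed

text \<open>The new maximum forms an increasing pair with exactly the \<open>k\<close> entries in
  front of it.\<close>

lemma list_inv_insert:
  assumes "\<forall>x\<in>set xs. x < m" "k \<le> length xs"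
  shows "list_inv (take k xs @ m # drop k xs) = list_inv xs + k"
  using assms
proof (induction xs arbitrary: k)
  case Nil
  then show ?case by simp
next
  case (Cons x xs)
  show ?case
  proof (cases k)
    case 0
    then have "{y. (y = x \<or> y \<in> set xs) \<and> m < y} = {}" using Cons.prems by auto
    then show ?thesis using 0 by simp
  next
    case (Suc j)
    have "set (take j xs @ m # drop j xs) = insert m (set xs)"
      by (metis Un_insert_right append_take_drop_id list.simps(15) set_append)
    then have "{y \<in> set (take j xs @ m # drop j xs). x < y} = insert m {y \<in> set xs. x < y}"
      using Cons.prems by auto
    moreover have "m \<notin> set xs" using Cons.prems by auto
    ultimately have "card {y \<in> set (take j xs @ m # drop j xs). x < y} = Suc (card {y \<in> set xs. x < y})"
      by simp
    then show ?thesis using Cons Suc by simp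
  qed
qed

lemma q_number_Suc: "q_number (Suc n) = (\<Sum>k\<le>n. monom 1 k)"
  by (simp add: q_number_def lessThan_Suc_atMost)

lemma q_fact_Suc: "q_fact (Suc n) = q_fact n * q_number (Suc n)"
  by (simp add: q_fact_def)

text \<open>Serves both constructions at \<open>t = 0\<close>: the \<open>n + 1\<close> choices
  raise the statistic by 0, ..., n, once each.\<close>

lemma sum_monom_shift:
  "(\<Sum>(x, k)\<in>A \<times> {..n}. monom (1 :: int) (f x + k)) = (\<Sum>x\<in>A. monom 1 (f x)) * q_number (Suc n)"
  by (simp add: q_number_Suc sum_product sum.cartesian_product mult_monom)

lemma sum_list_inv: "(\<Sum>xs\<in>perms n. monom 1 (list_inv xs)) = q_fact n"
proof (induction n)
  case 0
  then show ?case by (simp add: q_fact_def)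
next
  case (Suc n)
  have "(\<Sum>ys\<in>perms (Suc n). monom (1 :: int) (list_inv ys)) =
      (\<Sum>(xs, k)\<in>perms n \<times> {..n}. monom 1 (list_inv xs + k))"
    using list_inv_insert perms_D
    by (subst sum.reindex_bij_betw[OF bij_betw_insert_max, symmetric])
       (auto intro!: sum.cong simp: insert_max_def)
  then show ?case using Suc by (simp add: sum_monom_shift q_fact_Suc)
qed

subsection \<open>The Eulerian recurrence\<close>

primrec eulerian_rec :: "nat \<Rightarrow> int poly" where
  "eulerian_rec 0 = 1"
| "eulerian_rec (Suc n) =
     [:1, of_nat n:] * eulerian_rec n + [:0, 1, -1:] * pderiv (eulerian_rec n)"

text \<open>On \<open>t^s\<close> the recurrence operator describes one insertion:
  \<open>s + 1\<close> choices keep the exponent and \<open>n - s\<close> raise it. The difference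
  is taken in the polynomial ring, so it does not truncate.\<close>

lemma eulerian_monom:
  "[:1, of_nat n:] * monom 1 s + [:0, 1, -1:] * pderiv (monom 1 s) =
   of_nat (s + 1) * monom 1 s + (of_nat n - of_nat s) * monom (1 :: int) (Suc s)"
proof -
  have 1: "[:1, of_nat n:] = 1 + of_nat n * monom (1 :: int) 1"
    by (simp add: monom_altdef of_nat_poly one_pCons)
  have 2: "[:0, 1, -1:] = monom (1 :: int) 1 - monom 1 2"
    by (simp add: monom_altdef power2_eq_square)
  show ?thesis
  \<comment> \<open>Writing a positive \<open>s\<close> as \<open>Suc r\<close> turns the exponent
    \<open>s - 1\<close> of the derivative into \<open>r\<close>.\<close>
  proof (cases s)
    case 0
    then show ?thesis unfolding 1 2 by (simp add: mult_monom monom_0 pderiv_1 algebra_simps flip: one_pCons)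
  next
    case (Suc r)
    have "pderiv (monom (1 :: int) s) = of_nat s * monom 1 r"
      unfolding pderiv_monom Suc by (simp add: of_nat_poly smult_monom)
    then show ?thesis unfolding 1 2 Suc by (simp add: algebra_simps mult_monom)
  qed
qed

lemma pderiv_sum: "pderiv (\<Sum>x\<in>A. f x) = (\<Sum>x\<in>A. pderiv (f x))"
  by (induction A rule: infinite_finite_induct) (simp_all add: pderiv_add)

text \<open>The insertion argument shared by all three families. \<open>K x\<close> collects the
  choices that keep the statistic; its size depends on \<open>s x\<close> alone, so one step acts
  linearly on the powers of \<open>t\<close>.\<close>

lemma eulerian_step:
  fixes s :: "'a \<Rightarrow> nat" and s' :: "'b \<Rightarrow> nat"
  assumes bij: "bij_betw f (X \<times> {..n}) Y"
    and s': "\<And>x k. x \<in> X \<Longrightarrow> k \<le> n \<Longrightarrow> s' (f (x, k)) = s x + (if k \<in> K x then 0 else 1)"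
    and K: "\<And>x. x \<in> X \<Longrightarrow> K x \<subseteq> {..n}" "\<And>x. x \<in> X \<Longrightarrow> card (K x) = s x + 1"
    and IH: "(\<Sum>x\<in>X. monom 1 (s x)) = eulerian_rec n"
  shows "(\<Sum>y\<in>Y. monom 1 (s' y)) = eulerian_rec (Suc n)"
proof -
  have "(\<Sum>y\<in>Y. monom (1 :: int) (s' y)) = (\<Sum>z\<in>X \<times> {..n}. monom 1 (s' (f z)))"
    by (rule sum.reindex_bij_betw[OF bij, symmetric])
  also have "\<dots> = (\<Sum>x\<in>X. \<Sum>k\<le>n. monom 1 (s' (f (x, k))))"
    by (simp add: sum.cartesian_product case_prod_unfold)
  also have "\<dots> = (\<Sum>x\<in>X. [:1, of_nat n:] * monom 1 (s x) + [:0, 1, -1:] * pderiv (monom 1 (s x)))"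
  proof (rule sum.cong)
    fix x assume x: "x \<in> X"
    have fin: "finite (K x)" using K(1)[OF x] finite_subset by blast
    \<comment> \<open>Since \<open>K x\<close> has \<open>s x + 1\<close> elements among the
      \<open>n + 1\<close> choices, \<open>s x\<close> is at most \<open>n\<close> and the natural
      subtraction is exact.\<close>
    have card: "card ({..n} - K x) = n - s x" "s x \<le> n"
      using K[OF x] card_mono[OF _ K(1)[OF x]] by (simp_all add: card_Diff_subset[OF fin])
    have "(\<Sum>k\<le>n. monom (1 :: int) (s' (f (x, k)))) =
        (\<Sum>k\<in>K x. monom 1 (s' (f (x, k)))) + (\<Sum>k\<in>{..n} - K x. monom 1 (s' (f (x, k))))"
      using sum.subset_diff[OF K(1)[OF x]] by (simp add: add.commute)
    also have "\<dots> = (\<Sum>k\<in>K x. monom 1 (s x)) + (\<Sum>k\<in>{..n} - K x. monom 1 (Suc (s x)))"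
      using s'[OF x] K(1)[OF x] by (intro arg_cong2[of _ _ _ _ "(+)"] sum.cong) auto
    also have "\<dots> = of_nat (s x + 1) * monom 1 (s x) + (of_nat n - of_nat (s x)) * monom 1 (Suc (s x))"
      using card K(2)[OF x] by (simp add: of_nat_diff)
    finally show "(\<Sum>k\<le>n. monom (1 :: int) (s' (f (x, k)))) =
        [:1, of_nat n:] * monom 1 (s x) + [:0, 1, -1:] * pderiv (monom 1 (s x))"
      unfolding eulerian_monom .
  qed simp
  also have "\<dots> = [:1, of_nat n:] * (\<Sum>x\<in>X. monom 1 (s x)) +
      [:0, 1, -1:] * pderiv (\<Sum>x\<in>X. monom 1 (s x))"
    unfolding sum.distrib sum_distrib_left pderiv_sum ..
  finally show ?thesis unfolding IH by simp
qed

section \<open>Descents and excedances of permutations\<close>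

fun list_des :: "nat list \<Rightarrow> nat" where
  "list_des (x # y # zs) = (if x > y then 1 else 0) + list_des (y # zs)"
| "list_des _ = 0"

lemma list_des_append:
  "xs \<noteq> [] \<Longrightarrow> ys \<noteq> [] \<Longrightarrow>
    list_des (xs @ ys) = list_des xs + (if last xs > hd ys then 1 else 0) + list_des ys"
proof (induction xs rule: list_des.induct)
  case ("2_2" x)
  then show ?case by (cases ys) auto
qed auto

lemma list_des_conv_card: "list_des xs = card {k \<in> {0<..<length xs}. xs ! k < xs ! (k - 1)}"
proof (induction xs rule: rev_induct)
  case Nil
  then show ?case by simp
next
  case (snoc x xs)
  show ?case
  proof (cases "xs = []")
    case False
    let ?D = "\<lambda>xs. {k \<in> {0<..<length xs}. xs ! k < xs ! (k - 1)}"
    have "?D (xs @ [x]) = ?D xs \<union> (if x < last xs then {length xs} else {})"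
      using False by (auto simp: nth_append less_Suc_eq last_conv_nth)
    then show ?thesis using snoc False by (simp add: list_des_append)
  qed auto
qed

text \<open>A new maximum is followed by a descent unless it stands last, and is never preceded by
  one. So the count is kept only at the end or when the gap was already a descent.\<close>

lemma list_des_insert:
  assumes "\<forall>x\<in>set xs. x < m" "k \<le> length xs"
  shows "list_des (take k xs @ m # drop k xs) =
    list_des xs + (if k = length xs \<or> 0 < k \<and> k < length xs \<and> xs ! k < xs ! (k - 1) then 0 else 1)"
proof -
  consider "xs = []" | "k = 0" "xs \<noteq> []" | "k = length xs" "xs \<noteq> []" | "0 < k" "k < length xs"
    using assms by fastforce
  then show ?thesis
  proof cases
    case 2
    then obtain x ys where "xs = x # ys" by (cases xs) auto
    then show ?thesis using assms 2 by simp
  next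
    case 3
    then have "last xs < m" using assms by simp
    then show ?thesis using 3 by (simp add: list_des_append)
  next
    case 4
    let ?ys = "take k xs" and ?zs = "drop k xs"
    have ne: "?ys \<noteq> []" "?zs \<noteq> []" using 4 by auto
    have lh: "last ?ys = xs ! (k - 1)" "hd ?zs = xs ! k"
      using 4 ne by (simp_all add: hd_drop_conv_nth last_conv_nth)
    have lt: "xs ! (k - 1) < m" "xs ! k < m" using 4 assms by auto
    obtain z zs where zs: "?zs = z # zs" using ne by (cases ?zs) auto
    have "list_des (m # ?zs) = 1 + list_des ?zs" using lt lh zs by simp
    then have "list_des (?ys @ m # ?zs) = list_des ?ys + (1 + list_des ?zs)"
      using ne lt lh by (simp add: list_des_append)
    moreover have "list_des (?ys @ ?zs) = list_des ?ys + (if xs ! (k - 1) > xs ! k then 1 else 0) + list_des ?zs"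
      unfolding list_des_append[OF ne] lh ..
    ultimately show ?thesis using 4 by simp
  qed (use assms in simp)
qed

lemma sum_list_des: "(\<Sum>xs\<in>perms n. monom 1 (list_des xs)) = eulerian_rec n"
proof (induction n)
  case 0
  then show ?case by simp
next
  case (Suc n)
  let ?D = "\<lambda>xs. {k \<in> {0<..<length xs}. xs ! k < xs ! (k - 1)}"
  show ?case
  proof (rule eulerian_step[OF bij_betw_insert_max, where K = "\<lambda>xs. insert n (?D xs)", OF _ _ _ Suc])
    fix xs assume xs: "xs \<in> perms n"
    note D = perms_D[OF xs]
    show "insert n (?D xs) \<subseteq> {..n}" "card (insert n (?D xs)) = list_des xs + 1"
      using D by (auto simp: list_des_conv_card)
    fix k assume "k \<le> n"
    then show "list_des (insert_max (xs, k)) = list_des xs + (if k \<in> insert n (?D xs) then 0 else 1)"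
      using D list_des_insert[of xs "Suc n" k] by (auto simp: insert_max_def)
  qed
qed

text \<open>One-line notation is injective, and onto because both sides have \<open>n!\<close>
  elements.\<close>

lemma eulerian_poly_eq: "eulerian_poly n = eulerian_rec n"
proof -
  have "bij_betw (\<lambda>\<sigma>. map \<sigma> [1..<Suc n]) {\<sigma>. \<sigma> permutes {1..n}} (perms n)"
    unfolding bij_betw_def
  proof
    show inj: "inj_on (\<lambda>\<sigma>. map \<sigma> [1..<Suc n]) {\<sigma>. \<sigma> permutes {1..n}}"
    proof (rule inj_onI, rule ext)
      fix \<sigma> \<tau> i assume "\<sigma> \<in> {\<sigma>. \<sigma> permutes {1..n}}" "\<tau> \<in> {\<sigma>. \<sigma> permutes {1..n}}"
        and "map \<sigma> [1..<Suc n] = map \<tau> [1..<Suc n]"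
      then show "\<sigma> i = \<tau> i" by (cases "i \<in> {1..n}") (auto simp: permutes_not_in le_less)
    qed
    have "map \<sigma> [1..<Suc n] \<in> perms n" if "\<sigma> permutes {1..n}" for \<sigma>
      using permutes_image[OF that] permutes_inj_on[OF that]
      by (auto simp: permutations_of_set_def distinct_map atLeastLessThanSuc_atLeastAtMost simp del: upt_Suc)
    then have "(\<lambda>\<sigma>. map \<sigma> [1..<Suc n]) ` {\<sigma>. \<sigma> permutes {1..n}} \<subseteq> perms n" by auto
    moreover have "card ((\<lambda>\<sigma>. map \<sigma> [1..<Suc n]) ` {\<sigma>. \<sigma> permutes {1..n}}) = card (perms n)"
      unfolding card_image[OF inj] by (simp add: card_permutations)
    ultimately show "(\<lambda>\<sigma>. map \<sigma> [1..<Suc n]) ` {\<sigma>. \<sigma> permutes {1..n}} = perms n"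
      using card_subset_eq[of "perms n"] by simp
  qed
  then have "(\<Sum>xs\<in>perms n. monom (1 :: int) (list_des xs)) =
      (\<Sum>\<sigma> | \<sigma> permutes {1..n}. monom 1 (list_des (map \<sigma> [1..<Suc n])))"
    by (rule sum.reindex_bij_betw[symmetric])
  moreover have "list_des (map \<sigma> [1..<Suc n]) = des n \<sigma>" for \<sigma>
  proof -
    \<comment> \<open>Entry \<open>k\<close> of the list is \<open>\<sigma> (k + 1)\<close> and
      entry \<open>k - 1\<close> is \<open>\<sigma> k\<close>, so a descent has the same index on
      both sides.\<close>
    have "{k \<in> {0<..<n}. map \<sigma> [1..<Suc n] ! k < map \<sigma> [1..<Suc n] ! (k - 1)} =
        {i \<in> {1..n - 1}. \<sigma> i > \<sigma> (i + 1)}"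
      by (auto simp del: upt_Suc)
    then show ?thesis by (simp add: list_des_conv_card des_def del: upt_Suc)
  qed
  ultimately show ?thesis by (simp only: eulerian_poly_def sum_list_des)
qed

text \<open>In one-line notation, this inserts the new maximum after \<open>k + 1\<close> in its cycle, or
  as a fixed point if \<open>k = length xs\<close>.\<close>

definition replace_max :: "nat list \<times> nat \<Rightarrow> nat list" where
  "replace_max = (\<lambda>(xs, k). let ys = xs @ [Suc (length xs)] in
     ys[k := ys ! length xs, length xs := ys ! k])"

lemma nth_replace_max:
  assumes "xs \<in> perms n" "k \<le> n" "i \<le> n"
  shows "replace_max (xs, k) ! i = (if i = k then Suc n else if i = n then xs ! k else xs ! i)"
  using assms perms_D(1)[OF assms(1)]
  by (auto simp: replace_max_def Let_def nth_list_update nth_append)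

lemma length_replace_max [simp]: "length (replace_max (xs, k)) = Suc (length xs)"
  by (simp add: replace_max_def Let_def)

lemma bij_betw_replace_max: "bij_betw replace_max (perms n \<times> {..n}) (perms (Suc n))"
proof (rule bij_betw_perms_Suc)
  show "inj_on replace_max (perms n \<times> {..n})"
  proof (rule inj_onI, clarify)
    fix xs k ys j assume xs: "xs \<in> perms n" "k \<le> n" and ys: "ys \<in> perms n" "j \<le> n"
      and eq: "replace_max (xs, k) = replace_max (ys, j)"
    note len = perms_D(1)[OF xs(1)] perms_D(1)[OF ys(1)]
    have less: "xs ! i < Suc n" "ys ! i < Suc n" if "i < n" for i
      using that perms_D[OF xs(1)] perms_D[OF ys(1)] nth_mem[of i xs] nth_mem[of i ys] by auto
    \<comment> \<open>\<open>k\<close> is the only position holding the entry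
      \<open>Suc n\<close>.\<close>
    have k: "k = j"
    proof (rule ccontr)
      assume "k \<noteq> j"
      then have "replace_max (ys, j) ! k < Suc n"
        using nth_replace_max[OF ys xs(2)] less(2)[of k] less(2)[of j] xs(2) ys(2) by auto
      then show False using nth_replace_max[OF xs xs(2)] eq by simp
    qed
    have "xs ! i = ys ! i" if "i < n" for i
    proof (cases "i = k")
      case True
      then show ?thesis
        using nth_replace_max[OF xs, of n] nth_replace_max[OF ys, of n] eq k that by simp
    next
      case False
      then show ?thesis
        using nth_replace_max[OF xs, of i] nth_replace_max[OF ys, of i] eq k that by simp
    qed
    then show "xs = ys \<and> k = j" using len k by (simp add: nth_equalityI)
  qed
  show "replace_max ` (perms n \<times> {..n}) \<subseteq> perms (Suc n)"
  proof clarify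
    fix xs k assume xs: "xs \<in> perms n" "k \<le> n"
    \<comment> \<open>The construction swaps two entries of \<open>xs @ [Suc n]\<close>.\<close>
    have "mset (replace_max (xs, k)) = mset (xs @ [Suc n])"
      unfolding replace_max_def Let_def case_prod_conv perms_D(1)[OF xs(1)]
      by (rule mset_swap) (use xs perms_D in auto)
    then have "set (replace_max (xs, k)) = set (xs @ [Suc n])" "distinct (replace_max (xs, k))"
      using perms_D[OF xs(1)] by (metis mset_eq_setD, subst mset_eq_imp_distinct_iff[of _ "xs @ [Suc n]"], auto)
    then show "replace_max (xs, k) \<in> perms (Suc n)"
      using perms_D[OF xs(1)] by (auto simp: permutations_of_set_def)
  qed
qed

lemma exced_eq: "exced xs = card {i. i < length xs \<and> Suc i < xs ! i}"
proof -
  have "{i \<in> {1..length xs}. xs ! (i - 1) > i} = Suc ` {i. i < length xs \<and> Suc i < xs ! i}"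
  proof safe
    fix i assume "i \<in> {1..length xs}" "i < xs ! (i - 1)"
    then show "i \<in> Suc ` {i. i < length xs \<and> Suc i < xs ! i}"
      by (intro image_eqI[of _ _ "i - 1"]) auto
  qed auto
  then show ?thesis by (simp add: exced_def card_image)
qed

lemma sum_exced: "(\<Sum>xs\<in>perms n. monom 1 (exced xs)) = eulerian_rec n"
proof (induction n)
  case 0
  then show ?case by (simp add: exced_eq)
next
  case (Suc n)
  let ?D = "\<lambda>xs. {i. i < length xs \<and> Suc i < xs ! i}"
  \<comment> \<open>The last position receives an entry of size at most \<open>n\<close> or, if
    \<open>k = n\<close>, the fixed point \<open>Suc n\<close>, and is never an excedance. Position
    \<open>k < n\<close> receives the maximum and becomes one. So the count is kept for
    \<open>k = n\<close> and for \<open>k\<close> already an excedance.\<close>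
  show ?case
  proof (rule eulerian_step[OF bij_betw_replace_max, where K = "\<lambda>xs. insert n (?D xs)", OF _ _ _ Suc])
    fix xs assume xs: "xs \<in> perms n"
    note D = perms_D[OF xs]
    show "insert n (?D xs) \<subseteq> {..n}" "card (insert n (?D xs)) = exced xs + 1"
      using D by (auto simp: exced_eq)
    fix k assume k: "k \<le> n"
    have le: "xs ! i \<le> n" if "i < n" for i using that D nth_mem[of i xs] by auto
    have "?D (replace_max (xs, k)) = (if k = n then ?D xs else insert k (?D xs))"
    proof (rule set_eqI)
      fix i show "i \<in> ?D (replace_max (xs, k)) \<longleftrightarrow> i \<in> (if k = n then ?D xs else insert k (?D xs))"
        using nth_replace_max[OF xs k, of i] le[of k] D(1) k by (cases "i \<le> n") auto
    qed
    then show "exced (replace_max (xs, k)) = exced xs + (if k \<in> insert n (?D xs) then 0 else 1)"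
      by (simp add: exced_eq insert_absorb)
  qed
qed

subsection \<open>Parking functions\<close>

lemma sum_Suc: "(\<Sum>i<n. Suc i) = n + 1 choose 2"
  by (induction n) (auto simp: numeral_2_eq_2)

lemma sum_list_sort_nth: "sum_list (xs :: nat list) = (\<Sum>i<length xs. sort xs ! i)"
proof -
  have "sum_list xs = sum_list (sort xs)" by (metis mset_sort sum_mset_sum_list)
  then show ?thesis by (simp add: sum_list_sum_nth atLeast0LessThan)
qed

lemma PF_iff:
  "xs \<in> PF n \<longleftrightarrow> length xs = n \<and> (\<forall>x\<in>set xs. 1 \<le> x) \<and> (\<forall>i<n. sort xs ! i \<le> Suc i)"
proof -
  have "(\<forall>j\<in>{1..n}. sort xs ! (j - 1) \<le> j) \<longleftrightarrow> (\<forall>i<n. sort xs ! i \<le> Suc i)"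
    by (metis (no_types, lifting) One_nat_def Suc_le_eq Suc_pred' atLeastAtMost_iff diff_Suc_1 le_SucI
        le_simps(2) not_less_eq_eq zero_less_Suc)
  then show ?thesis by (simp add: PF_def)
qed

text \<open>The sorted entries are bounded by 1, ..., n, whose sum is the binomial coefficient in
  \<open>cosum\<close>; equality of the sums forces equality of every entry.\<close>

lemma PF_cosum_0: "{xs \<in> PF n. cosum xs = 0} = perms n"
proof (intro equalityI subsetI)
  fix xs assume "xs \<in> {xs \<in> PF n. cosum xs = 0}"
  then have xs: "xs \<in> PF n" "cosum xs = 0" by auto
  have len: "length xs = n" and le: "\<And>i. i < n \<Longrightarrow> sort xs ! i \<le> Suc i" using xs by (auto simp: PF_iff)
  \<comment> \<open>Truncated subtraction yields only this inequality; together with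
    \<open>le\<close> it suffices.\<close>
  have ge: "(\<Sum>i<n. Suc i) \<le> (\<Sum>i<n. sort xs ! i)"
    using xs(2) sum_list_sort_nth[of xs] by (simp only: cosum_def len sum_Suc)
  have "sort xs ! i = Suc i" if "i < n" for i
  proof (rule ccontr)
    assume "sort xs ! i \<noteq> Suc i"
    then have "sort xs ! i < Suc i" using le[OF that] by simp
    then have "(\<Sum>i<n. sort xs ! i) < (\<Sum>i<n. Suc i)"
      using that le by (intro sum_strict_mono_ex1) auto
    then show False using ge by simp
  qed
  then have "sort xs = [1..<Suc n]" by (intro nth_equalityI) (auto simp: len simp del: upt_Suc)
  then have "set xs = {1..n}" "distinct xs"
    by (metis atLeastLessThanSuc_atLeastAtMost set_sort set_upt, metis distinct_sort distinct_upt)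
  then show "xs \<in> perms n" by (simp add: permutations_of_set_def)
next
  fix xs assume xs: "xs \<in> perms n"
  note D = perms_D[OF xs]
  have "sort xs = [1..<Suc n]"
    using D by (intro sorted_distinct_set_unique)
      (simp_all only: sorted_sort distinct_sort set_sort sorted_upt distinct_upt set_upt
        atLeastLessThanSuc_atLeastAtMost)
  then have nth: "sort xs ! i = Suc i" if "i < n" for i using that by (simp del: upt_Suc)
  then have "sum_list xs = n + 1 choose 2"
    using D(1) sum_Suc[of n] by (simp add: sum_list_sort_nth)
  then show "xs \<in> {xs \<in> PF n. cosum xs = 0}"
    using D nth by (auto simp: PF_iff cosum_def)
qed

text \<open>Counting the entries that are at most \<open>Suc k\<close>: the first
  \<open>k + 1\<close> entries of \<open>xs\<close> are among them, but there would be at most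
  \<open>k\<close> if the sorted entry at index \<open>k\<close> were larger.\<close>

lemma sort_nth_le:
  assumes "\<forall>i<length xs. xs ! i \<le> Suc i" "k < length xs"
  shows "sort xs ! k \<le> Suc k"
proof (rule ccontr)
  assume *: "\<not> sort xs ! k \<le> Suc k"
  let ?P = "\<lambda>x. x \<le> Suc k"
  have "{..k} \<subseteq> {i. i < length xs \<and> ?P (xs ! i)}"
  proof
    fix i assume "i \<in> {..k}"
    then have "i < length xs" "xs ! i \<le> Suc i" "Suc i \<le> Suc k" using assms by auto
    then show "i \<in> {i. i < length xs \<and> ?P (xs ! i)}" by simp
  qed
  then have "Suc k \<le> length (filter ?P xs)"
    unfolding length_filter_conv_card
    using card_mono[of "{i. i < length xs \<and> ?P (xs ! i)}" "{..k}"] by simp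
  also have "length (filter ?P xs) = length (filter ?P (sort xs))"
    by (simp add: filter_sort)
  also have "\<dots> = card {i. i < length xs \<and> ?P (sort xs ! i)}"
    by (simp add: length_filter_conv_card)
  also have "\<dots> \<le> card {..<k}"
  proof (rule card_mono)
    show "{i. i < length xs \<and> ?P (sort xs ! i)} \<subseteq> {..<k}"
    proof
      fix i assume "i \<in> {i. i < length xs \<and> ?P (sort xs ! i)}"
      then have i: "i < length xs" "sort xs ! i \<le> Suc k" by auto
      then show "i \<in> {..<k}"
        using * sorted_nth_mono[OF sorted_sort, of k i xs] by (cases "i < k") auto
    qed
  qed simp
  finally show False by simp
qed

definition subdiagonal :: "nat \<Rightarrow> nat list set" where
  "subdiagonal n = {xs. length xs = n \<and> (\<forall>i<n. 1 \<le> xs ! i \<and> xs ! i \<le> Suc i)}"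

lemma PF_exced_0: "{xs \<in> PF n. exced xs = 0} = subdiagonal n"
proof -
  have "exced xs = 0 \<longleftrightarrow> (\<forall>i<length xs. xs ! i \<le> Suc i)" for xs
    by (simp add: exced_eq) (metis not_less)
  then show ?thesis
    using sort_nth_le by (auto simp: PF_iff subdiagonal_def all_set_conv_all_nth)
qed

lemma bij_betw_subdiagonal:
  "bij_betw (\<lambda>(xs, k). xs @ [Suc n - k]) (subdiagonal n \<times> {..n}) (subdiagonal (Suc n))"
  unfolding bij_betw_def
proof
  show "inj_on (\<lambda>(xs, k). xs @ [Suc n - k]) (subdiagonal n \<times> {..n})"
    by (auto simp: inj_on_def)
  have "ys \<in> (\<lambda>(xs, k). xs @ [Suc n - k]) ` (subdiagonal n \<times> {..n})" if "ys \<in> subdiagonal (Suc n)" for ys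
  proof -
    have len: "length ys = Suc n" and ys: "\<forall>i<Suc n. 1 \<le> ys ! i \<and> ys ! i \<le> Suc i"
      using that by (auto simp: subdiagonal_def)
    obtain xs x where ysx: "ys = xs @ [x]" using len by (metis length_0_conv nat.distinct(1) rev_exhaust)
    then have "length xs = n" using len by simp
    then have "1 \<le> x" "x \<le> Suc n" using ys[rule_format, of n] ysx by auto
    moreover have "xs \<in> subdiagonal n"
      using ys ysx \<open>length xs = n\<close> unfolding subdiagonal_def by (auto simp: nth_append less_Suc_eq)
    ultimately show ?thesis using ysx by (intro image_eqI[of _ _ "(xs, Suc n - x)"]) auto
  qed
  moreover have "xs @ [Suc n - k] \<in> subdiagonal (Suc n)" if "xs \<in> subdiagonal n" "k \<le> n" for xs k
    using that by (auto simp: subdiagonal_def nth_append less_Suc_eq)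
  ultimately show "(\<lambda>(xs, k). xs @ [Suc n - k]) ` (subdiagonal n \<times> {..n}) = subdiagonal (Suc n)"
    by auto
qed

lemma sum_cosum: "(\<Sum>xs\<in>subdiagonal n. monom 1 (cosum xs)) = q_fact n"
proof (induction n)
  case 0
  have "subdiagonal 0 = {[]}" by (auto simp: subdiagonal_def)
  then show ?case by (simp add: q_fact_def cosum_def numeral_2_eq_2)
next
  case (Suc n)
  \<comment> \<open>The binomial coefficient grows by \<open>n + 1\<close> and the sum by
    \<open>n + 1 - k\<close>; this is why the new entry is written as
    \<open>Suc n - k\<close>.\<close>
  have cosum: "cosum (xs @ [Suc n - k]) = cosum xs + k" if "xs \<in> subdiagonal n" "k \<le> n" for xs k
  proof -
    have "xs \<in> PF n" using that PF_exced_0 by blast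
    then have "sum_list xs \<le> n + 1 choose 2" "length xs = n" using PF_sum_list_le by (auto simp: PF_iff)
    then show ?thesis using that by (simp add: cosum_def numeral_2_eq_2)
  qed
  have "(\<Sum>ys\<in>subdiagonal (Suc n). monom (1 :: int) (cosum ys)) =
      (\<Sum>(xs, k)\<in>subdiagonal n \<times> {..n}. monom 1 (cosum xs + k))"
    by (subst sum.reindex_bij_betw[OF bij_betw_subdiagonal, symmetric])
       (auto intro!: sum.cong simp: cosum)
  then show ?case using Suc by (simp add: sum_monom_shift q_fact_Suc)
qed

subsection \<open>Generating functions of trees\<close>

text \<open>With truncated subtraction the condition says at most one leaf, which is the hypothesis
  of \<open>list_tree_surj\<close>.\<close>

lemma bij_betw_list_tree:
  "bij_betw list_tree (perms n) {T \<in> Tree (n + 1). tree_lev (n + 1) T - 1 = 0}"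
  unfolding bij_betw_def
proof
  have V: "{..<n + 1} = insert 0 {1..n}" by auto
  show "inj_on list_tree (perms n)"
  proof (rule inj_onI)
    fix xs ys assume "xs \<in> perms n" "ys \<in> perms n" "list_tree xs = list_tree ys"
    then show "xs = ys" using perms_D[of xs n] perms_D[of ys n] by (intro list_tree_inj) auto
  qed
  show "list_tree ` perms n = {T \<in> Tree (n + 1). tree_lev (n + 1) T - 1 = 0}"
  proof (intro equalityI subsetI)
    fix T assume "T \<in> list_tree ` perms n"
    then obtain xs where xs: "xs \<in> perms n" "T = list_tree xs" by blast
    then have "distinct xs" "0 \<notin> set xs" "{..<n + 1} = insert 0 (set xs)"
      using perms_D[OF xs(1)] V by auto
    then show "T \<in> {T \<in> Tree (n + 1). tree_lev (n + 1) T - 1 = 0}"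
      using list_tree_properties[of xs] xs(2) by (simp add: Tree_iff_tree_on tree_lev_eq)
  next
    fix T assume "T \<in> {T \<in> Tree (n + 1). tree_lev (n + 1) T - 1 = 0}"
    then have "tree_on {..<n + 1} T" "card (leaves {..<n + 1} T) \<le> 1"
      by (auto simp: Tree_iff_tree_on tree_lev_eq)
    then obtain xs where xs: "distinct xs" "0 \<notin> set xs" "{..<n + 1} = insert 0 (set xs)" "T = list_tree xs"
      using list_tree_surj[of "{..<n + 1}" T] by auto
    have "set xs = {1..n}" using xs(2,3) V by (metis Diff_insert_absorb atLeastAtMost_iff not_one_le_zero)
    then show "T \<in> list_tree ` perms n" using xs by (auto simp: permutations_of_set_def)
  qed
qed

text \<open>The choices that keep the statistic are the leaves themselves: attaching the new vertex
  at a leaf exchanges one leaf for another.\<close>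

lemma sum_increasing_trees:
  "(\<Sum>T\<in>increasing_trees n. monom 1 (tree_lev (n + 1) T - 1)) = eulerian_rec n"
proof (induction n)
  case 0
  then show ?case by (simp add: increasing_trees_0 tree_lev_eq leaves_empty)
next
  case (Suc n)
  have step: "leaves {..Suc n} (insert {v, Suc n} T) = insert (Suc n) (leaves {..n} T - {v})"
    if "T \<in> increasing_trees n" "v \<le> n" for T v
    using tree_pendant.leaves_pendant[OF increasing_tree_pendant[OF that]] by (simp add: atMost_Suc)
  have fin: "finite (leaves {..n} T)" for n T by (simp add: leaves_def)
  \<comment> \<open>There is always a leaf, for instance the largest label, so
    \<open>tree_lev - 1\<close> does not truncate and \<open>K\<close> has the size that
    \<open>eulerian_step\<close> requires.\<close>
  have pos: "card (leaves {..n} T) > 0" if "T \<in> increasing_trees n" for T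
  proof (cases n)
    case 0
    then show ?thesis using that by (simp add: increasing_trees_0 leaves_empty)
  next
    case (Suc m)
    then have "T \<in> (\<lambda>(T, v). insert {v, Suc m} T) ` (increasing_trees m \<times> {..m})"
      using that bij_betw_increasing_trees[of m] unfolding bij_betw_def by simp
    then obtain S v where "S \<in> increasing_trees m" "v \<le> m" "T = insert {v, Suc m} S" by auto
    then have "Suc m \<in> leaves {..n} T"
      using tree_pendant.leaves_pendant[OF increasing_tree_pendant] Suc by (simp add: atMost_Suc)
    then show ?thesis using fin card_gt_0_iff by blast
  qed
  show ?case
  proof (rule eulerian_step[OF bij_betw_increasing_trees, where K = "leaves {..n}", OF _ _ _ Suc])
    fix T assume T: "T \<in> increasing_trees n"
    show "leaves {..n} T \<subseteq> {..n}" by (auto simp: leaves_def)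
    show "card (leaves {..n} T) = tree_lev (n + 1) T - 1 + 1"
      using pos[OF T] by (simp add: tree_lev_eq lessThan_Suc_atMost)
    fix v assume v: "v \<le> n"
    have "Suc n \<notin> leaves {..n} T" by (auto simp: leaves_def)
    then show "tree_lev (Suc n + 1) (case (T, v) of (T, v) \<Rightarrow> insert {v, Suc n} T) - 1 =
        tree_lev (n + 1) T - 1 + (if v \<in> leaves {..n} T then 0 else 1)"
      using pos[OF T] fin step[OF T v] by (auto simp: tree_lev_eq lessThan_Suc_atMost card_Diff_singleton)
  qed
qed

theorem theorem1:
  fixes n :: nat
  shows "subst_t_0 (I_poly n) = q_fact n \<and> subst_t_0 (I_tilde_poly n) = q_fact n \<and>
         subst_q_0 (I_poly n) = eulerian_poly n \<and> subst_q_0 (I_tilde_poly n) = eulerian_poly n"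
proof (intro conjI)
  have inv: "tree_inv (n + 1) (list_tree xs) = list_inv xs" if "xs \<in> perms n" for xs
  proof -
    have "{..<n + 1} = insert 0 (set xs)" "distinct xs" "0 \<notin> set xs"
      using perms_D[OF that] by auto
    then show ?thesis using list_tree_properties(4)[of xs] by (simp add: tree_inv_eq)
  qed
  have "(\<Sum>xs\<in>perms n. monom (1 :: int) (tree_inv (n + 1) (list_tree xs))) = q_fact n"
    unfolding sum_list_inv[symmetric] by (intro sum.cong refl) (simp only: inv)
  moreover have "subst_t_0 (I_poly n) = (\<Sum>xs\<in>perms n. monom 1 (tree_inv (n + 1) (list_tree xs)))"
    unfolding I_poly_def subst_t_0_sum[OF finite_Tree]
    by (rule sum.reindex_bij_betw[OF bij_betw_list_tree, symmetric])
  ultimately show "subst_t_0 (I_poly n) = q_fact n" by simp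
  show "subst_t_0 (I_tilde_poly n) = q_fact n"
    unfolding I_tilde_poly_def subst_t_0_sum[OF finite_PF] PF_exced_0 sum_cosum ..
  show "subst_q_0 (I_poly n) = eulerian_poly n"
    unfolding I_poly_def subst_q_0_sum[OF finite_Tree] eulerian_poly_eq
    using sum_increasing_trees by (simp add: increasing_trees_def)
  show "subst_q_0 (I_tilde_poly n) = eulerian_poly n"
    unfolding I_tilde_poly_def subst_q_0_sum[OF finite_PF] PF_cosum_0 sum_exced eulerian_poly_eq ..
qed

end
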